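(* Let $n\ge 1$ and consider any transversal design $\mathrm{TD}(3,n)$. Xeno (the first player) has a winning strategy in Tic-Tac-Toe on it if and only if $n\ge 3$.
   Context: A transversal design $\mathrm{TD}(k,n)$ is a triple $(X,\mathcal{G},\mathcal{B})$ where $X$ is a set of $kn$ points, $\mathcal{G}$ is a partition of $X$ into $k$ subsets of cardinality $n$ (the groups), and $\mathcal{B}$ is a set of $k$-element subsets of $X$ (the blocks) such that every pair of points not in the same group appears in exactly one block, and no block contains two points of the same group. Tic-Tac-Toe on a design: two players, Xeno (first) and Ophelia (second), alternately choose points not chosen before; the first player to have chosen all the points of some block wins. If all points are chosen and nobody has completed a block, the game is a draw. Only the blocks (not the groups) are winning sets. *)

theory Defs
  imports Main "HOL-Library.Disjoint_Sets"
begin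

definition transversal_design ::
    "nat \<Rightarrow> nat \<Rightarrow> 'a set \<Rightarrow> 'a set set \<Rightarrow> 'a set set \<Rightarrow> bool" where
  "transversal_design k n X \<G> \<B> \<longleftrightarrow>
     finite X \<and> card X = k * n \<and>
     partition_on X \<G> \<and> card \<G> = k \<and> (\<forall>g\<in>\<G>. card g = n) \<and>
     (\<forall>b\<in>\<B>. b \<subseteq> X \<and> card b = k) \<and>
     (\<forall>x\<in>X. \<forall>y\<in>X. \<not> (\<exists>g\<in>\<G>. x \<in> g \<and> y \<in> g) \<longrightarrow> (\<exists>!b. b \<in> \<B> \<and> x \<in> b \<and> y \<in> b)) \<and>
     (\<forall>b\<in>\<B>. \<forall>g\<in>\<G>. \<forall>x\<in>b. \<forall>y\<in>b. x \<in> g \<longrightarrow> y \<in> g \<longrightarrow> x = y)"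

text \<open>
  A position is the list of points chosen so far, in the order in which they were chosen.
  Indices start at 0, so the first player, Xeno, owns the even ones and Ophelia the odd ones.
\<close>

definition xeno_points :: "'a list \<Rightarrow> 'a set" where
  "xeno_points p = {p ! i | i. i < length p \<and> even i}"

definition ophelia_points :: "'a list \<Rightarrow> 'a set" where
  "ophelia_points p = {p ! i | i. i < length p \<and> odd i}"

definition has_block :: "'a set set \<Rightarrow> 'a set \<Rightarrow> bool" where
  "has_block \<B> S \<longleftrightarrow> (\<exists>b\<in>\<B>. b \<subseteq> S)"

definition game_over :: "'a set \<Rightarrow> 'a set set \<Rightarrow> 'a list \<Rightarrow> bool" where
  "game_over X \<B> p \<longleftrightarrow>
     has_block \<B> (xeno_points p) \<or> has_block \<B> (ophelia_points p) \<or> set p = X"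

text \<open>
  No move is made once the game is over. Hence in a legal position at most one player has
  completed a block, and a player who has completed one was the first to do so.
\<close>

definition legal_position :: "'a set \<Rightarrow> 'a set set \<Rightarrow> 'a list \<Rightarrow> bool" where
  "legal_position X \<B> p \<longleftrightarrow>
     distinct p \<and> set p \<subseteq> X \<and> (\<forall>i<length p. \<not> game_over X \<B> (take i p))"

definition xeno_follows :: "('a list \<Rightarrow> 'a) \<Rightarrow> 'a list \<Rightarrow> bool" where
  "xeno_follows \<sigma> p \<longleftrightarrow> (\<forall>i<length p. even i \<longrightarrow> p ! i = \<sigma> (take i p))"

text \<open>
  A strategy maps positions to moves. The first conjunct requires its moves to be legal;
  otherwise a strategy whose moves are illegal would win vacuously. A draw is not a win.
\<close>

definition xeno_winning_strategy :: "'a set \<Rightarrow> 'a set set \<Rightarrow> ('a list \<Rightarrow> 'a) \<Rightarrow> bool" where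
  "xeno_winning_strategy X \<B> \<sigma> \<longleftrightarrow>
     (\<forall>p. legal_position X \<B> p \<and> xeno_follows \<sigma> p \<and> even (length p) \<and> \<not> game_over X \<B> p
        \<longrightarrow> \<sigma> p \<in> X - set p) \<and>
     (\<forall>p. legal_position X \<B> p \<and> xeno_follows \<sigma> p \<and> game_over X \<B> p
        \<longrightarrow> has_block \<B> (xeno_points p))"

end

theory Submission imports Defs begin

text \<open>
  For \<open>n \<ge> 3\<close> Xeno forces a double threat by his third move. If Ophelia answers \<open>r1\<close> with a point
  \<open>r2\<close> of the same group, Xeno takes a third point \<open>r3\<close> of it; whether Xeno next chooses a point
  outside the group freely or is forced to by Ophelia's threat, this point together with \<open>r1\<close> and
  with \<open>r3\<close> gives two threats. If she answers with \<open>c1\<close> in another group, Xeno takes a point \<open>s\<close>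
  of the third group not on the block through \<open>r1\<close> and \<open>c1\<close>; Ophelia has to respond in the group
  of \<open>c1\<close>, and any further point of that group again gives two threats.

  For \<open>n \<le> 2\<close> Ophelia answers in another group. The blocks that she does not hit then
  contain disjoint pairs of free points, so a pairing strategy prevents Xeno from winning.
\<close>

section \<open>Positions as pairs of point sets\<close>

text \<open>\<open>P\<close> and \<open>Q\<close> are the points held by Xeno and Ophelia, with Xeno
  to move. As a least fixed point it admits only wins in finitely many moves. In
  \<open>move\<close>, the premise \<open>insert a (P \<union> Q) \<noteq> X\<close> rules out
  draws: on a full board the premises about Ophelia's replies would hold vacuously.\<close>

inductive xeno_wins :: "'a set \<Rightarrow> 'a set set \<Rightarrow> 'a set \<Rightarrow> 'a set \<Rightarrow> bool" for X \<B> where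
  finish: "a \<in> X - P - Q \<Longrightarrow> has_block \<B> (insert a P) \<Longrightarrow> xeno_wins X \<B> P Q"
| move: "a \<in> X - P - Q \<Longrightarrow> insert a (P \<union> Q) \<noteq> X \<Longrightarrow>
     (\<And>b. b \<in> X - insert a P - Q \<Longrightarrow> \<not> has_block \<B> (insert b Q)) \<Longrightarrow>
     (\<And>b. b \<in> X - insert a P - Q \<Longrightarrow> xeno_wins X \<B> (insert a P) (insert b Q)) \<Longrightarrow>
     xeno_wins X \<B> P Q"

section \<open>Plays extended by one move\<close>

lemma xeno_points_Nil [simp]: "xeno_points [] = {}"
  and ophelia_points_Nil [simp]: "ophelia_points [] = {}"
  by (auto simp: xeno_points_def ophelia_points_def)

lemma xeno_points_snoc [simp]:
  "xeno_points (p @ [a :: 'a]) = (if even (length p) then insert a (xeno_points p) else xeno_points p)"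
proof -
  have "{i. i < length (p @ [a]) \<and> even i} =
      (if even (length p) then insert (length p) else id) {i. i < length p \<and> even i}"
    by (auto simp: less_Suc_eq)
  moreover have "(!) (p @ [a]) ` {i. i < length p \<and> even i} = (!) p ` {i. i < length p \<and> even i}"
    by (rule image_cong) (auto simp: nth_append)
  moreover have "xeno_points q = (!) q ` {i. i < length q \<and> even i}" for q :: "'a list"
    by (auto simp: xeno_points_def)
  ultimately show ?thesis by simp
qed

lemma ophelia_points_snoc [simp]:
  "ophelia_points (p @ [a :: 'a]) =
     (if even (length p) then ophelia_points p else insert a (ophelia_points p))"
proof -
  have "{i. i < length (p @ [a]) \<and> odd i} =
      (if odd (length p) then insert (length p) else id) {i. i < length p \<and> odd i}"
    by (auto simp: less_Suc_eq)
  moreover have "(!) (p @ [a]) ` {i. i < length p \<and> odd i} = (!) p ` {i. i < length p \<and> odd i}"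
    by (rule image_cong) (auto simp: nth_append)
  moreover have "ophelia_points q = (!) q ` {i. i < length q \<and> odd i}" for q :: "'a list"
    by (auto simp: ophelia_points_def)
  ultimately show ?thesis by simp
qed

lemma set_eq_xeno_Un_ophelia: "set p = xeno_points p \<union> ophelia_points p"
  by (induction p rule: rev_induct) auto

lemma legal_position_snoc:
  "legal_position X \<B> (p @ [a]) \<longleftrightarrow> legal_position X \<B> p \<and> \<not> game_over X \<B> p \<and> a \<in> X - set p"
  by (auto simp: legal_position_def All_less_Suc)

lemma xeno_follows_snoc:
  "xeno_follows \<sigma> (p @ [a]) \<longleftrightarrow> xeno_follows \<sigma> p \<and> (even (length p) \<longrightarrow> a = \<sigma> p)"
  by (auto simp: xeno_follows_def All_less_Suc nth_append)

text \<open>Induction on the number of free points: \<open>\<sigma>\<close> supplies Xeno's move,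
  and each reply of Ophelia leads to a longer position that still follows
  \<open>\<sigma>\<close>.\<close>

lemma strategy_imp_xeno_wins:
  assumes "finite X" and \<sigma>: "xeno_winning_strategy X \<B> \<sigma>"
    and "legal_position X \<B> p" "xeno_follows \<sigma> p" "even (length p)" "\<not> game_over X \<B> p"
  shows "xeno_wins X \<B> (xeno_points p) (ophelia_points p)"
  using assms(3-)
proof (induction "card (X - set p)" arbitrary: p rule: less_induct)
  case less
  have won: "has_block \<B> (xeno_points q)"
    if "legal_position X \<B> q" "xeno_follows \<sigma> q" "game_over X \<B> q" for q
    using \<sigma> that by (auto simp: xeno_winning_strategy_def)
  define a where "a = \<sigma> p"
  have a: "a \<in> X - set p"
    using \<sigma> less.prems by (auto simp: xeno_winning_strategy_def a_def)
  have pa: "legal_position X \<B> (p @ [a])" "xeno_follows \<sigma> (p @ [a])"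
    using less.prems a by (auto simp: legal_position_snoc xeno_follows_snoc a_def)
  have aPQ: "a \<in> X - xeno_points p - ophelia_points p"
    using a by (auto simp: set_eq_xeno_Un_ophelia)
  show ?case
  proof (cases "has_block \<B> (insert a (xeno_points p))")
    case True
    then show ?thesis using aPQ by (rule xeno_wins.finish[rotated])
  next
    case False
    then have not_over: "\<not> game_over X \<B> (p @ [a])"
      using won[OF pa] less.prems by auto
    have step: "\<not> has_block \<B> (insert b (ophelia_points p)) \<and>
        xeno_wins X \<B> (insert a (xeno_points p)) (insert b (ophelia_points p))"
      if "b \<in> X - insert a (xeno_points p) - ophelia_points p" for b
    proof -
      let ?q = "p @ [a] @ [b]"
      have b: "b \<in> X - set (p @ [a])"
        using that by (auto simp: set_eq_xeno_Un_ophelia)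
      then have q: "legal_position X \<B> ?q" "xeno_follows \<sigma> ?q"
        using pa not_over less.prems(3)
        by (simp_all only: append_assoc[symmetric] legal_position_snoc xeno_follows_snoc) auto
      have points: "xeno_points ?q = insert a (xeno_points p)"
          "ophelia_points ?q = insert b (ophelia_points p)"
        using less.prems(3)
        by (simp_all only: append_assoc[symmetric] xeno_points_snoc ophelia_points_snoc) auto
      \<comment> \<open>A finished game would give Xeno a block, but he holds only the points he had
        after \<open>a\<close>, which contain none.\<close>
      have over: "\<not> game_over X \<B> ?q"
        using won[OF q] False points by auto
      have "card (X - set ?q) < card (X - set p)"
        using a b \<open>finite X\<close> by (intro psubset_card_mono) auto
      then have "xeno_wins X \<B> (xeno_points ?q) (ophelia_points ?q)"
        using less.hyps q over less.prems(3) by simp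
      then show ?thesis
        using over points by (auto simp: game_over_def)
    qed
    have "insert a (xeno_points p \<union> ophelia_points p) \<noteq> X"
      using not_over by (auto simp: game_over_def set_eq_xeno_Un_ophelia[symmetric])
    then show ?thesis
      using aPQ step by (blast intro: xeno_wins.move)
  qed
qed

text \<open>The strategy picks any move that witnesses \<open>xeno_wins\<close>; an invariant along
  all plays following it shows that Xeno stays in winning positions.\<close>

lemma xeno_wins_imp_strategy:
  assumes win: "xeno_wins X \<B> {} {}" and "\<not> has_block \<B> {}"
  shows "\<exists>\<sigma>. xeno_winning_strategy X \<B> \<sigma>"
proof -
  \<comment> \<open>What the two introduction rules of \<open>xeno_wins\<close> demand of the move
    \<open>a\<close>, so inversion yields a good free point.\<close>
  define good where "good P Q a \<longleftrightarrow> has_block \<B> (insert a P) \<or>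
      insert a (P \<union> Q) \<noteq> X \<and> (\<forall>b \<in> X - insert a P - Q. \<not> has_block \<B> (insert b Q) \<and>
        xeno_wins X \<B> (insert a P) (insert b Q))" for P Q a
  define \<sigma> where
    "\<sigma> p = (SOME a. a \<in> X - set p \<and> good (xeno_points p) (ophelia_points p) a)" for p
  have \<sigma>: "\<sigma> p \<in> X - set p" "good (xeno_points p) (ophelia_points p) (\<sigma> p)"
    if "xeno_wins X \<B> (xeno_points p) (ophelia_points p)" for p
  proof -
    have "\<exists>a. a \<in> X - set p \<and> good (xeno_points p) (ophelia_points p) a"
      using that by cases (auto simp: good_def set_eq_xeno_Un_ophelia)
    from someI_ex[OF this] show "\<sigma> p \<in> X - set p" "good (xeno_points p) (ophelia_points p) (\<sigma> p)"
      by (auto simp: \<sigma>_def)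
  qed
  \<comment> \<open>Even length: Xeno is to move in an undecided winning position. Odd length: he
    has just won, or the board is not full and every reply of Ophelia leads back to the even
    case.\<close>
  define inv where "inv p \<longleftrightarrow> (if even (length p)
      then \<not> has_block \<B> (xeno_points p) \<and> \<not> has_block \<B> (ophelia_points p) \<and>
           xeno_wins X \<B> (xeno_points p) (ophelia_points p)
      else has_block \<B> (xeno_points p) \<or> \<not> has_block \<B> (ophelia_points p) \<and> set p \<noteq> X \<and>
           (\<forall>b \<in> X - set p. \<not> has_block \<B> (insert b (ophelia_points p)) \<and>
              xeno_wins X \<B> (xeno_points p) (insert b (ophelia_points p))))" for p
  have inv: "inv p" if "legal_position X \<B> p" "xeno_follows \<sigma> p" for p
    using that
  proof (induction p rule: rev_induct)
    case Nil
    then show ?case using assms by (simp add: inv_def)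
  next
    case (snoc a p)
    then have p: "inv p" "\<not> game_over X \<B> p" "a \<in> X - set p" "even (length p) \<longrightarrow> a = \<sigma> p"
      by (auto simp: legal_position_snoc xeno_follows_snoc)
    show ?case
    proof (cases "even (length p)")
      case True
      then have "good (xeno_points p) (ophelia_points p) a"
        using p \<sigma> by (auto simp: inv_def)
      then show ?thesis
        using True p by (auto simp: inv_def good_def game_over_def set_eq_xeno_Un_ophelia)
    next
      case False
      then show ?thesis
        using p by (auto simp: inv_def game_over_def)
    qed
  qed
  have "xeno_winning_strategy X \<B> \<sigma>"
    unfolding xeno_winning_strategy_def
  proof (intro conjI allI impI; elim conjE)
    fix p assume "legal_position X \<B> p" "xeno_follows \<sigma> p" "even (length p)"
    then show "\<sigma> p \<in> X - set p"
      using inv[of p] \<sigma>(1)[of p] by (auto simp: inv_def)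
  next
    fix p assume p: "legal_position X \<B> p" "xeno_follows \<sigma> p" and over: "game_over X \<B> p"
    show "has_block \<B> (xeno_points p)"
    proof (cases "even (length p)")
      case True
      then have "xeno_wins X \<B> (xeno_points p) (ophelia_points p)"
        using inv[OF p] by (simp add: inv_def)
      \<comment> \<open>Winning positions contain a free point, namely the next move.\<close>
      then have "set p \<noteq> X" using \<sigma>(1) by blast
      then show ?thesis using over inv[OF p] True by (auto simp: inv_def game_over_def)
    next
      case False
      then show ?thesis using over inv[OF p] by (auto simp: inv_def game_over_def)
    qed
  qed
  then show ?thesis by blast
qed

lemma ex_strategy_iff_xeno_wins:
  assumes "finite X" "X \<noteq> {}" "\<not> has_block \<B> {}"
  shows "(\<exists>\<sigma>. xeno_winning_strategy X \<B> \<sigma>) \<longleftrightarrow> xeno_wins X \<B> {} {}"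
proof
  assume "\<exists>\<sigma>. xeno_winning_strategy X \<B> \<sigma>"
  then obtain \<sigma> where "xeno_winning_strategy X \<B> \<sigma>" ..
  from strategy_imp_xeno_wins[OF \<open>finite X\<close> this, of "[]"] show "xeno_wins X \<B> {} {}"
    using assms by (auto simp: legal_position_def xeno_follows_def game_over_def)
next
  assume "xeno_wins X \<B> {} {}"
  then show "\<exists>\<sigma>. xeno_winning_strategy X \<B> \<sigma>"
    using \<open>\<not> has_block \<B> {}\<close> by (rule xeno_wins_imp_strategy)
qed

text \<open>The pairs in \<open>D\<close> guard all blocks that Ophelia has not hit: whenever Xeno
  takes one point of a pair she takes the other. The hypotheses are the invariant of this play, and
  induction on \<open>xeno_wins\<close> shows that Xeno never finishes.\<close>

lemma pairing_strategy:
  assumes "xeno_wins X \<B> P Q" and "P \<union> Q \<subseteq> X" and "P \<inter> Q = {}"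
    and "\<And>d. d \<in> D \<Longrightarrow> card d = 2 \<and> d \<subseteq> X - P - Q" and "disjoint D"
    and "\<And>b. b \<in> \<B> \<Longrightarrow> b \<inter> Q \<noteq> {} \<or> (\<exists>d\<in>D. d \<subseteq> b)"
  shows False
  using assms
proof (induction arbitrary: D rule: xeno_wins.induct)
  case (finish a P Q)
  then obtain b where b: "b \<in> \<B>" "b \<subseteq> insert a P" by (auto simp: has_block_def)
  then have "b \<inter> Q = {}" using finish.hyps(1) finish.prems(2) by auto
  then obtain d where d: "d \<in> D" "d \<subseteq> b" using finish.prems(5) b by blast
  \<comment> \<open>The pair consists of free points, so within \<open>insert a P\<close> only
    \<open>a\<close> is available to it.\<close>
  then have "d \<subseteq> {a}" using finish.prems(3)[of d] b by blast
  then have "card d \<le> 1" using card_mono[of "{a}" d] by simp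
  then show ?case using finish.prems(3)[OF d(1)] by simp
next
  case (move a P Q)
  \<comment> \<open>Ophelia's answer: the partner of \<open>a\<close> if \<open>a\<close> lies in a
    pair, otherwise any free point, which exists because the board is not full.\<close>
  have "\<exists>c \<in> X - insert a P - Q. \<forall>d\<in>D. a \<in> d \<longrightarrow> c \<in> d"
  proof (cases "\<exists>d\<in>D. a \<in> d")
    case True
    then obtain d where d: "d \<in> D" "a \<in> d" by blast
    obtain c where "c \<in> d" "c \<noteq> a"
      using move.prems(3)[OF d(1)] by (metis d(2) card_2_iff')
    moreover have "e = d" if "e \<in> D" "a \<in> e" for e
      using \<open>disjoint D\<close> d that by (auto simp: pairwise_def disjnt_def)
    ultimately show ?thesis
      using move.prems(3)[OF d(1)] by blast
  next
    case False
    then show ?thesis using move.hyps(1,2) move.prems(1) by blast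
  qed
  then obtain c where c: "c \<in> X - insert a P - Q" "\<And>d. d \<in> D \<Longrightarrow> a \<in> d \<Longrightarrow> c \<in> d"
    by blast
  show ?case
  \<comment> \<open>A dropped pair contains \<open>c\<close>, so the blocks around it are now hit.
    The remaining pairs avoid \<open>a\<close> too, since a pair with \<open>a\<close> also contains
    \<open>c\<close>.\<close>
  proof (rule move.IH[OF c(1), of "{d \<in> D. c \<notin> d}"])
    show "insert a P \<union> insert c Q \<subseteq> X" using move.hyps(1) move.prems(1) c(1) by auto
    show "insert a P \<inter> insert c Q = {}" using move.hyps(1) move.prems(2) c(1) by auto
    show "disjoint {d \<in> D. c \<notin> d}" using \<open>disjoint D\<close> by (auto simp: pairwise_def)
    show "card d = 2 \<and> d \<subseteq> X - insert a P - insert c Q" if "d \<in> {d \<in> D. c \<notin> d}" for d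
      using move.prems(3)[of d] that c by auto
    show "b \<inter> insert c Q \<noteq> {} \<or> (\<exists>d\<in>{d \<in> D. c \<notin> d}. d \<subseteq> b)" if "b \<in> \<B>" for b
      using move.prems(5)[OF that] by blast
  qed
qed

section \<open>Transversal designs with three groups\<close>

locale transversal_design_3 =
  fixes n :: nat and X :: "'a set" and \<G> \<B> :: "'a set set"
  assumes n: "n \<ge> 1" and design: "transversal_design 3 n X \<G> \<B>"
begin

definition same_group :: "'a \<Rightarrow> 'a \<Rightarrow> bool" where
  "same_group x y \<longleftrightarrow> (\<exists>g\<in>\<G>. x \<in> g \<and> y \<in> g)"

text \<open>As a symmetric ternary relation the blocks form a Latin square: any two entries
  determine the third.\<close>

definition block :: "'a \<Rightarrow> 'a \<Rightarrow> 'a \<Rightarrow> bool" where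
  "block x y z \<longleftrightarrow> {x, y, z} \<in> \<B>"

lemma finite_X: "finite X" and card_X: "card X = 3 * n" and partition: "partition_on X \<G>"
  and card_groups: "card \<G> = 3" and card_group: "g \<in> \<G> \<Longrightarrow> card g = n"
  and block_subset: "b \<in> \<B> \<Longrightarrow> b \<subseteq> X" and card_block: "b \<in> \<B> \<Longrightarrow> card b = 3"
  using design unfolding transversal_design_def by simp_all

lemma ex1_block: "x \<in> X \<Longrightarrow> y \<in> X \<Longrightarrow> \<not> same_group x y \<Longrightarrow> \<exists>!b. b \<in> \<B> \<and> x \<in> b \<and> y \<in> b"
  using design unfolding transversal_design_def same_group_def by simp

lemma block_transversal: "b \<in> \<B> \<Longrightarrow> x \<in> b \<Longrightarrow> y \<in> b \<Longrightarrow> same_group x y \<Longrightarrow> x = y"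
proof -
  have "\<forall>b\<in>\<B>. \<forall>g\<in>\<G>. \<forall>x\<in>b. \<forall>y\<in>b. x \<in> g \<longrightarrow> y \<in> g \<longrightarrow> x = y"
    using design unfolding transversal_design_def by simp
  then show "b \<in> \<B> \<Longrightarrow> x \<in> b \<Longrightarrow> y \<in> b \<Longrightarrow> same_group x y \<Longrightarrow> x = y"
    unfolding same_group_def by blast
qed

lemma group_unique: "g \<in> \<G> \<Longrightarrow> h \<in> \<G> \<Longrightarrow> x \<in> g \<Longrightarrow> x \<in> h \<Longrightarrow> g = h"
  using partition unfolding partition_on_def pairwise_def disjnt_def by blast

lemma ex_group: "x \<in> X \<Longrightarrow> \<exists>g\<in>\<G>. x \<in> g"
  using partition by (auto simp: partition_on_def)

lemma same_group_refl: "x \<in> X \<Longrightarrow> same_group x x"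
  using ex_group by (auto simp: same_group_def)

lemma same_group_sym: "same_group x y \<Longrightarrow> same_group y x"
  by (auto simp: same_group_def)

lemma same_group_trans: "same_group x y \<Longrightarrow> same_group y z \<Longrightarrow> same_group x z"
  unfolding same_group_def using group_unique by metis

lemma same_group_in_X: "same_group x y \<Longrightarrow> x \<in> X \<and> y \<in> X"
  using partition unfolding partition_on_def same_group_def by blast

section \<open>Blocks as triples\<close>

lemma block_perm: "block x y z \<Longrightarrow> block y x z" "block x y z \<Longrightarrow> block x z y"
  by (simp_all add: block_def insert_commute)

lemma block_in_X: "block x y z \<Longrightarrow> x \<in> X \<and> y \<in> X \<and> z \<in> X"
  using block_subset by (auto simp: block_def)

lemma block_distinct:
  assumes "block x y z" shows "x \<noteq> y \<and> x \<noteq> z \<and> y \<noteq> z"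
proof -
  have "card {x, y, z} = 3" using card_block assms by (simp add: block_def)
  then show ?thesis by (simp add: card_insert_if split: if_splits)
qed

lemma block_not_same_group:
  assumes "block x y z"
  shows "\<not> same_group x y" "\<not> same_group x z" "\<not> same_group y z"
proof -
  have "{x, y, z} \<in> \<B>" using assms by (simp add: block_def)
  note eq = block_transversal[OF this]
  show "\<not> same_group x y" "\<not> same_group x z" "\<not> same_group y z"
    using eq[of x y] eq[of x z] eq[of y z] block_distinct[OF assms] by auto
qed

lemma ex_third:
  assumes "x \<in> X" "y \<in> X" "\<not> same_group x y"
  shows "\<exists>z. block x y z"
proof -
  obtain b where b: "b \<in> \<B>" "x \<in> b" "y \<in> b" using ex1_block[OF assms] by blast
  have "x \<noteq> y" using assms same_group_refl by blast
  then have "card (b - {x, y}) = 1"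
    using b card_block[OF b(1)] by (subst card_Diff_subset) auto
  then obtain z where "b - {x, y} = {z}" by (rule card_1_singletonE)
  then have "b = {x, y, z}" using b by blast
  then show ?thesis using b by (auto simp: block_def)
qed

lemma third_unique:
  assumes "block x y z" "block x y w" shows "z = w"
proof -
  have "{x, y, z} = {x, y, w}"
    using ex1_block[of x y] block_not_same_group(1)[OF assms(1)] block_in_X[OF assms(1)] assms
    unfolding block_def by blast
  then have "z \<in> {x, y, w}" by blast
  then show ?thesis using block_distinct[OF assms(1)] by auto
qed

lemma blockE:
  assumes "b \<in> \<B>" obtains x y z where "b = {x, y, z}" "block x y z"
  using card_block[OF assms] assms unfolding card_3_iff block_def by blast

text \<open>Pigeonhole: \<open>x\<close>, \<open>y\<close> and \<open>z\<close> already occupy all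
  three groups.\<close>

lemma same_group_cases:
  assumes "\<not> same_group x y" "\<not> same_group x z" "\<not> same_group y z"
    "x \<in> X" "y \<in> X" "z \<in> X" "w \<in> X"
  shows "same_group x w \<or> same_group y w \<or> same_group z w"
proof -
  obtain gx gy gz gw where g: "gx \<in> \<G>" "x \<in> gx" "gy \<in> \<G>" "y \<in> gy" "gz \<in> \<G>" "z \<in> gz"
    "gw \<in> \<G>" "w \<in> gw"
    using ex_group[OF assms(4)] ex_group[OF assms(5)] ex_group[OF assms(6)] ex_group[OF assms(7)]
    by blast
  then have "gx \<noteq> gy" "gx \<noteq> gz" "gy \<noteq> gz"
    using assms(1-3) unfolding same_group_def by blast+
  then have "card {gx, gy, gz} = 3" by simp
  then have "{gx, gy, gz} = \<G>"
    using g card_groups by (intro card_subset_eq) (auto intro: card_ge_0_finite)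
  then have "gw = gx \<or> gw = gy \<or> gw = gz" using g(7) by blast
  then show ?thesis using g unfolding same_group_def by blast
qed

lemma card_same_group: "x \<in> X \<Longrightarrow> card {y. same_group x y} = n"
proof -
  assume "x \<in> X"
  then obtain g where "g \<in> \<G>" "x \<in> g" using ex_group by blast
  then have "{y. same_group x y} = g" using group_unique unfolding same_group_def by blast
  then show ?thesis using card_group \<open>g \<in> \<G>\<close> by simp
qed

text \<open>This is where the size of \<open>n\<close> enters: it supplies a second point of a group
  if \<open>n \<ge> 2\<close>, and a third if \<open>n \<ge> 3\<close>.\<close>

lemma ex_same_group_avoiding:
  assumes "x \<in> X" "finite A" "card A < n"
  shows "\<exists>y. same_group x y \<and> y \<notin> A"
proof (rule ccontr)
  assume "\<not> ?thesis"
  then have "{y. same_group x y} \<subseteq> A" by blast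
  then show False using card_mono[OF \<open>finite A\<close>] card_same_group[OF \<open>x \<in> X\<close>] assms(3)
    by (metis leD)
qed

lemma X_not_empty: "X \<noteq> {}"
  using card_X n by auto

lemma ex_other_group:
  assumes "x \<in> X" shows "\<exists>y\<in>X. \<not> same_group x y"
proof (rule ccontr)
  assume "\<not> ?thesis"
  then have "X = {y. same_group x y}" using same_group_in_X by blast
  then show False using card_same_group[OF assms] card_X n by simp
qed

lemma not_has_block_small: "finite S \<Longrightarrow> card S \<le> 2 \<Longrightarrow> \<not> has_block \<B> S"
  unfolding has_block_def using card_block card_mono[of S]
  by (metis Suc_n_not_le_n eval_nat_numeral(3) order_trans)

lemma has_block_triple: "has_block \<B> {x, y, z} \<Longrightarrow> block x y z"
proof -
  assume "has_block \<B> {x, y, z}"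
  then obtain b where b: "b \<in> \<B>" "b \<subseteq> {x, y, z}" by (auto simp: has_block_def)
  have "card {x, y, z} \<le> 3" by (simp add: card_insert_if)
  then have "b = {x, y, z}"
    using b card_block[OF b(1)] by (intro card_seteq) auto
  then show ?thesis using b by (simp add: block_def)
qed

section \<open>Xeno's strategy\<close>

lemma win_by_threat:
  assumes "block x y z" "x \<in> P" "y \<in> P" "z \<notin> P" "z \<notin> Q"
  shows "xeno_wins X \<B> P Q"
proof (rule xeno_wins.finish[of z])
  show "z \<in> X - P - Q" using assms block_in_X by auto
  show "has_block \<B> (insert z P)" 
    using assms unfolding has_block_def block_def by (intro bexI[of _ "{x, y, z}"]) auto
qed

text \<open>After \<open>a\<close>, Xeno can complete a block at \<open>u\<close> and at
  \<open>v\<close>; Ophelia occupies at most one of them, and by \<open>safe\<close> her reply does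
  not win.\<close>

lemma win_by_double_threat:
  assumes "a \<in> X - P - Q" and "block a x u" "block a y v" "x \<in> P" "y \<in> P" "u \<noteq> v"
    and "u \<notin> P" "u \<notin> Q" "v \<notin> P" "v \<notin> Q"
    and safe: "\<And>b. b \<in> X - insert a P - Q \<Longrightarrow> \<not> has_block \<B> (insert b Q)"
  shows "xeno_wins X \<B> P Q"
proof (rule xeno_wins.move[OF assms(1) _ safe])
  have distinct: "u \<noteq> a" "v \<noteq> a" using assms block_distinct by blast+
  then show "insert a (P \<union> Q) \<noteq> X" using assms block_in_X by blast
  show "xeno_wins X \<B> (insert a P) (insert b Q)" for b
    using win_by_threat[of a x u "insert a P" "insert b Q"]
      win_by_threat[of a y v "insert a P" "insert b Q"] assms distinct by auto
qed

lemma win_same_group_reply: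
  assumes "n \<ge> 3" "same_group r1 r2" "r1 \<noteq> r2"
  shows "xeno_wins X \<B> {r1} {r2}"
proof -
  have X: "r1 \<in> X" "r2 \<in> X" using assms same_group_in_X by auto
  have "\<exists>y. same_group r1 y \<and> y \<notin> {r1, r2}"
    using assms X by (intro ex_same_group_avoiding) (auto simp: card_insert_if)
  then obtain r3 where r3: "same_group r1 r3" "r3 \<noteq> r1" "r3 \<noteq> r2" by auto
  then have "r3 \<in> X" using same_group_in_X by blast
  \<comment> \<open>The double threat from a point \<open>a\<close> outside the group. The
    completing points must avoid \<open>o2\<close>; they avoid \<open>r2\<close> automatically,
    lying outside its group.\<close>
  have double: "xeno_wins X \<B> (insert r3 {r1}) (insert o2 {r2})"
    if a: "a \<in> X - {r1, r2, r3, o2}" "\<not> same_group r1 a" and o2: "o2 \<in> X - {r1, r2, r3}"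
      and thirds: "\<not> block a r1 o2" "\<not> block a r3 o2"
      and safe: "\<And>b. b \<in> X - {a, r1, r3, r2, o2} \<Longrightarrow> \<not> block b r2 o2" for a o2
  proof -
    have "\<not> same_group a r1" "\<not> same_group a r3"
      using a r3 same_group_sym same_group_trans by blast+
    then obtain u v where uv: "block a r1 u" "block a r3 v"
      using ex_third a X \<open>r3 \<in> X\<close> by blast
    \<comment> \<open>A common point would, together with \<open>a\<close>, determine both
      \<open>r1\<close> and \<open>r3\<close>.\<close>
    have "u \<noteq> v" using uv r3(2) third_unique block_perm by blast
    moreover have "\<not> same_group r1 u" "\<not> same_group r3 v"
      using block_not_same_group uv by blast+
    then have "u \<noteq> r1 \<and> u \<noteq> r2 \<and> u \<noteq> r3" "v \<noteq> r1 \<and> v \<noteq> r2 \<and> v \<noteq> r3"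
      using assms r3 X same_group_refl same_group_sym same_group_trans by blast+
    moreover have "\<not> has_block \<B> (insert b (insert o2 {r2}))"
      if "b \<in> X - insert a (insert r3 {r1}) - insert o2 {r2}" for b
      using safe[of b] that has_block_triple[of b o2 r2] block_perm by blast
    ultimately show ?thesis
      using uv a thirds
      by (intro win_by_double_threat[of a _ _ r1 u r3 v]) auto
  qed
  show ?thesis
  proof (rule xeno_wins.move[of r3])
    show "r3 \<in> X - {r1} - {r2}" using r3 \<open>r3 \<in> X\<close> by simp
    obtain y where "y \<in> X" "\<not> same_group r1 y" using ex_other_group X by blast
    then show "insert r3 ({r1} \<union> {r2}) \<noteq> X"
      using r3 assms X same_group_refl by blast
  next
    fix o2 assume "o2 \<in> X - insert r3 {r1} - {r2}"
    then have o2: "o2 \<in> X - {r1, r2, r3}" by blast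
    show "\<not> has_block \<B> (insert o2 {r2})"
      by (rule not_has_block_small) (auto simp: card_insert_if)
    show "xeno_wins X \<B> (insert r3 {r1}) (insert o2 {r2})"
    proof (cases "same_group r1 o2")
      case True
      \<comment> \<open>Ophelia's two points share a group and threaten nothing, so any point
        outside the group will do.\<close>
      obtain a where a: "a \<in> X" "\<not> same_group r1 a" using ex_other_group X by blast
      then have "a \<notin> {r1, r2, r3, o2}" using True r3 assms X same_group_refl by blast
      moreover have "\<not> same_group r1 o2" if "block a r1 o2 \<or> block a r3 o2"
        using that block_not_same_group same_group_trans same_group_sym r3 by blast
      moreover have "\<not> block b r2 o2" for b
        using block_not_same_group True assms same_group_trans same_group_sym by blast
      ultimately show ?thesis using a True o2 double by blast
    next
      case False
      then have "\<not> same_group r2 o2" using assms same_group_trans by blast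
      \<comment> \<open>Ophelia threatens exactly at \<open>s\<close>, so Xeno plays there. The
        block through \<open>s\<close> and \<open>o2\<close> meets the group of \<open>r1\<close> in
        \<open>r2\<close>, so \<open>o2\<close> stops neither of his threats.\<close>
      then obtain s where s: "block r2 o2 s" using ex_third X o2 by blast
      have "\<not> same_group r2 s" "s \<noteq> o2" "s \<in> X"
        using s block_not_same_group block_distinct block_in_X by blast+
      then have "\<not> same_group r1 s" "s \<notin> {r1, r2, r3, o2}"
        using assms r3 X same_group_refl same_group_trans same_group_sym by blast+
      moreover have "\<not> block s r1 o2" "\<not> block s r3 o2"
        using s assms r3 third_unique block_perm by blast+
      moreover have "b = s" if "block b r2 o2" for b
        using s that third_unique block_perm by blast
      ultimately show ?thesis using \<open>s \<in> X\<close> o2 double[of s o2] by blast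
    qed
  qed
qed

text \<open>Xeno's move \<open>s\<close> forces Ophelia to \<open>c\<close>, in the group of
  \<open>c1\<close>. Her two points then lie on no common block, which leaves Xeno a free move for a
  double threat.\<close>

lemma win_other_group_reply:
  assumes "n \<ge> 3" "r1 \<in> X" "c1 \<in> X" "\<not> same_group r1 c1"
  shows "xeno_wins X \<B> {r1} {c1}"
proof -
  obtain s0 where s0: "block r1 c1 s0" using ex_third assms by blast
  then have "s0 \<in> X" using block_in_X by blast
  \<comment> \<open>Staying in the group of \<open>s0\<close> but off the block through
    \<open>r1\<close> and \<open>c1\<close> ensures that \<open>c1\<close> does not already stop the
    threat on \<open>r1\<close> and \<open>s\<close>.\<close>
  then obtain s where s: "same_group s0 s" "s \<noteq> s0"
    using ex_same_group_avoiding[of s0 "{s0}"] assms(1) by auto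
  then have "s \<in> X" using same_group_in_X by blast
  have s_other: "\<not> same_group r1 s" "\<not> same_group c1 s"
    using s s0 block_not_same_group same_group_trans same_group_sym by blast+
  then have s_neq: "s \<noteq> r1" "s \<noteq> c1" using assms same_group_refl by blast+
  obtain c where c: "block r1 s c" using ex_third s_other assms \<open>s \<in> X\<close> by blast
  have "c \<noteq> c1" using c s s0 third_unique block_perm by blast
  have c_neq: "c \<in> X" "c \<noteq> r1" "c \<noteq> s" using c block_in_X block_distinct by blast+
  have c_group: "same_group c1 c"
    using same_group_cases[of r1 c1 s c] assms s_other \<open>s \<in> X\<close> c_neq(1) block_not_same_group[OF c]
    by blast
  show ?thesis
  proof (rule xeno_wins.move[of s])
    show "s \<in> X - {r1} - {c1}" using \<open>s \<in> X\<close> s_neq by simp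
    show "insert s ({r1} \<union> {c1}) \<noteq> X" using c_neq \<open>c \<noteq> c1\<close> by blast
  next
    fix o2 assume o2: "o2 \<in> X - insert s {r1} - {c1}"
    show "\<not> has_block \<B> (insert o2 {c1})"
      by (rule not_has_block_small) (auto simp: card_insert_if)
    show "xeno_wins X \<B> (insert s {r1}) (insert o2 {c1})"
    proof (cases "o2 = c")
      case False
      then show ?thesis
        using c c_neq \<open>c \<noteq> c1\<close> by (intro win_by_threat[of r1 s c]) auto
    next
      case True
      \<comment> \<open>The double threat starts from a third point of the group of
        \<open>c1\<close> and \<open>c\<close>; its completing points lie outside this group, hence
        are not Ophelia's.\<close>
      have "\<exists>y. same_group c1 y \<and> y \<notin> {c1, c}"
        using assms by (intro ex_same_group_avoiding) (auto simp: card_insert_if)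
      then obtain a where a: "same_group c1 a" "a \<noteq> c1" "a \<noteq> c" by auto
      then have "a \<in> X" using same_group_in_X by blast
      have a_other: "\<not> same_group a r1" "\<not> same_group a s"
        using a s_other assms same_group_trans same_group_sym by blast+
      then obtain u v where uv: "block a r1 u" "block a s v"
        using ex_third \<open>a \<in> X\<close> assms \<open>s \<in> X\<close> by blast
      \<comment> \<open>Otherwise \<open>a\<close> would be on the block through \<open>r1\<close>
        and \<open>s\<close>, whose third point is \<open>c\<close>.\<close>
      have "u \<noteq> s" "v \<noteq> r1" using uv c a third_unique block_perm by blast+
      have "\<not> same_group c1 u" "\<not> same_group c1 v"
        using uv block_not_same_group a same_group_trans same_group_sym by blast+
      then have "u \<noteq> c1 \<and> u \<noteq> c" "v \<noteq> c1 \<and> v \<noteq> c"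
        using c_group same_group_refl assms by blast+
      moreover have "u \<noteq> r1" "v \<noteq> s" using uv block_distinct by blast+
      moreover have "u \<noteq> v"
        using uv s_neq third_unique block_perm by blast
      moreover have "a \<noteq> r1" "a \<noteq> s" using a_other \<open>a \<in> X\<close> same_group_refl by blast+
      moreover have "\<not> has_block \<B> (insert b {c, c1})" for b
        using has_block_triple[of b c c1] block_not_same_group(3) c_group same_group_sym by blast
      ultimately show ?thesis
        using uv a \<open>a \<in> X\<close> \<open>u \<noteq> s\<close> \<open>v \<noteq> r1\<close> True
        by (intro win_by_double_threat[of a _ _ r1 u s v]) auto
    qed
  qed
qed

lemma xeno_wins_if_large:
  assumes "n \<ge> 3" shows "xeno_wins X \<B> {} {}"
proof -
  obtain r where r: "r \<in> X" using X_not_empty by blast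
  show ?thesis
  proof (rule xeno_wins.move[of r])
    show "r \<in> X - {} - {}" using r by simp
    show "insert r ({} \<union> {}) \<noteq> X" using card_X n by auto
    fix b assume "b \<in> X - insert r {} - {}"
    then show "xeno_wins X \<B> {r} {b}"
      using win_same_group_reply[OF assms, of r b] win_other_group_reply[OF assms r, of b] by auto
    show "\<not> has_block \<B> (insert b {})" by (rule not_has_block_small) simp_all
  qed
qed

section \<open>Ophelia's strategy\<close>

lemma same_group_small:
  assumes "n \<le> 2" "same_group x y" "same_group x z" "y \<noteq> x" "z \<noteq> x"
  shows "y = z"
proof (rule ccontr)
  assume "y \<noteq> z"
  then have "card {x, y, z} = 3" using assms by (auto simp: card_insert_if)
  moreover have "{x, y, z} \<subseteq> {y. same_group x y}"
    using assms same_group_in_X same_group_refl by blast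
  moreover have "finite {y. same_group x y}"
    by (rule finite_subset[OF _ finite_X]) (use same_group_in_X in blast)
  ultimately show False
    using card_mono card_same_group same_group_in_X assms(1,2) by (metis not_less_eq_eq
        numeral_2_eq_2 numeral_3_eq_3 order_trans)
qed

text \<open>The three points of a block lie in different groups, and there are only three
  groups.\<close>

lemma block_meets_group:
  assumes "b \<in> \<B>" "x \<in> X" obtains y where "y \<in> b" "same_group x y"
proof -
  obtain u v w where b: "b = {u, v, w}" "block u v w" using assms blockE by blast
  then have "same_group u x \<or> same_group v x \<or> same_group w x"
    using same_group_cases block_not_same_group[OF b(2)] block_in_X[OF b(2)] assms(2) by blast
  then show thesis using that b same_group_sym by blast
qed

lemma block_eq:
  assumes "b \<in> \<B>" "x \<in> b" "y \<in> b" "block x y z" shows "b = {x, y, z}"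
  using assms ex1_block[of x y] block_in_X[OF assms(4)] block_not_same_group(1)[OF assms(4)]
  unfolding block_def by blast

lemma not_xeno_wins_small_reply:
  assumes "n \<le> 2" "r \<in> X" "c \<in> X" "\<not> same_group r c"
  shows "\<not> xeno_wins X \<B> {r} {c}"
proof
  assume win: "xeno_wins X \<B> {r} {c}"
  have "r \<noteq> c" using assms same_group_refl by blast
  show False
  proof (cases "n = 1")
    case True
    \<comment> \<open>With groups of size one, \<open>c\<close> lies on every block, so the empty
      set of pairs suffices.\<close>
    have "c \<in> b" if b: "b \<in> \<B>" for b
    proof -
      obtain y where y: "y \<in> b" "same_group c y" using block_meets_group b assms(3) by blast
      obtain g where "{y. same_group c y} = {g}"
        using card_same_group[OF assms(3)] True card_1_singletonE by metis
      then have "y \<in> {g}" "c \<in> {g}" using y same_group_refl assms(3) by blast+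
      then have "y = c" by simp
      then show ?thesis using y by simp
    qed
    then show False
      by (intro pairing_strategy[OF win, of "{}"]) (use \<open>r \<noteq> c\<close> assms(2,3) in auto)
  next
    case False
    then have "n > 1" using n by simp
    then obtain r' c' where r': "same_group r r'" "r' \<noteq> r" and c': "same_group c c'" "c' \<noteq> c"
      using ex_same_group_avoiding[of r "{r}"] ex_same_group_avoiding[of c "{c}"] assms by auto
    have X: "r' \<in> X" "c' \<in> X" using r' c' same_group_in_X by blast+
    have other: "\<not> same_group r c'" "\<not> same_group r' c'" "\<not> same_group r' c"
      using r' c' assms same_group_sym same_group_trans by blast+
    obtain w w' where w: "block r c' w" and w': "block r' c' w'"
      using ex_third other X assms by blast
    have "w \<noteq> w'" using w w' r' third_unique block_perm by blast
    have w_other: "\<not> same_group r w" "\<not> same_group c w" "\<not> same_group r w'" "\<not> same_group c w'"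
      using block_not_same_group[OF w] block_not_same_group[OF w'] r' c'
        same_group_trans same_group_sym by blast+
    have neq: "w \<noteq> r" "w \<noteq> r'" "w \<noteq> c" "w \<noteq> c'" "w' \<noteq> r" "w' \<noteq> r'" "w' \<noteq> c" "w' \<noteq> c'"
      "r' \<noteq> c'" "r' \<noteq> c" "c' \<noteq> r"
      using w_other r'(1) c'(1) other same_group_refl[OF assms(2)] same_group_refl[OF assms(3)]
        same_group_refl[OF X(1)] same_group_refl[OF X(2)] by blast+
    have "w \<in> X" "w' \<in> X" using w w' block_in_X by blast+
    \<comment> \<open>A block missing \<open>c\<close> contains \<open>c'\<close>, and either
      \<open>r\<close> or \<open>r'\<close>, so it is \<open>{r, c', w}\<close> or
      \<open>{r', c', w'}\<close>. In the first, \<open>r\<close> is Xeno's and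
      \<open>{c', w}\<close> is the free pair; in the second, \<open>{r', w'}\<close> is chosen to
      be disjoint from it.\<close>
    have hit: "b \<inter> {c} \<noteq> {} \<or> (\<exists>d\<in>{{c', w}, {r', w'}}. d \<subseteq> b)" if b: "b \<in> \<B>" for b
    proof (cases "c \<in> b")
      case False
      obtain y where y: "y \<in> b" "same_group c y" using block_meets_group b assms(3) by blast
      then have "y \<noteq> c" using False by blast
      then have "y = c'" by (rule same_group_small[OF assms(1) y(2) c'(1) _ c'(2)])
      then have c'b: "c' \<in> b" using y by simp
      obtain x where x: "x \<in> b" "same_group r x" using block_meets_group b assms(2) by blast
      show ?thesis
      proof (cases "x = r")
        case True
        then have "b = {r, c', w}" using block_eq[OF b _ c'b w] x(1) by simp
        then show ?thesis by simp
      next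
        case False
        then have "x = r'" by (rule same_group_small[OF assms(1) x(2) r'(1) _ r'(2)])
        then have "b = {r', c', w'}" using block_eq[OF b _ c'b w'] x(1) by simp
        then show ?thesis by simp
      qed
    qed simp
    show False
    proof (rule pairing_strategy[OF win, of "{{c', w}, {r', w'}}"])
      show "disjoint {{c', w}, {r', w'}}"
        using neq(2,8,9) \<open>w \<noteq> w'\<close> unfolding pairwise_def disjnt_def by blast
      show "card d = 2 \<and> d \<subseteq> X - {r} - {c}" if "d \<in> {{c', w}, {r', w'}}" for d
      proof -
        have "card {c', w} = 2" "card {r', w'} = 2"
          using neq by simp_all
        moreover have "{c', w} \<subseteq> X - {r} - {c}" "{r', w'} \<subseteq> X - {r} - {c}"
          using neq X \<open>w \<in> X\<close> \<open>w' \<in> X\<close> r'(2) c'(2) by simp_all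
        ultimately show ?thesis using that by blast
      qed
      show "{r} \<union> {c} \<subseteq> X" "{r} \<inter> {c} = {}" using \<open>r \<noteq> c\<close> assms(2,3) by simp_all
    qed (rule hit)
  qed
qed

lemma not_xeno_wins_if_small:
  assumes "n \<le> 2" shows "\<not> xeno_wins X \<B> {} {}"
proof
  assume "xeno_wins X \<B> {} {}"
  then show False
  proof cases
    case (finish r)
    then show False using not_has_block_small[of "{r}"] by simp
  next
    case (move r)
    then have "r \<in> X" by simp
    then obtain c where c: "c \<in> X" "\<not> same_group r c" using ex_other_group by blast
    then have "c \<noteq> r" using same_group_refl by blast
    then show False
      using move(4)[of c] not_xeno_wins_small_reply[OF assms \<open>r \<in> X\<close>] c by auto
  qed
qed

end

theorem theorem3p7:
  fixes n :: nat and X :: "'a set" and \<G> \<B> :: "'a set set"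
  assumes "n \<ge> 1" and "transversal_design 3 n X \<G> \<B>"
  shows "(\<exists>\<sigma>. xeno_winning_strategy X \<B> \<sigma>) \<longleftrightarrow> n \<ge> 3"
proof -
  interpret transversal_design_3 n X \<G> \<B>
    using assms by unfold_locales
  have "(\<exists>\<sigma>. xeno_winning_strategy X \<B> \<sigma>) \<longleftrightarrow> xeno_wins X \<B> {} {}"
    using finite_X X_not_empty not_has_block_small[of "{}"]
    by (intro ex_strategy_iff_xeno_wins) auto
  then show ?thesis
    using xeno_wins_if_large not_xeno_wins_if_small by fastforce
qed

end
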